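(* Let $\beta,\kappa:\mathbb{Z}^+\to\mathbb{Z}^+$ be positive integer functions such that $\beta(n)$ is $o(\sqrt{n})$ and $\kappa(n)$ is $o(\sqrt{n})$ as $n\to\infty$. Let $M$ be a matroid of rank $n$ whose girth $g$ satisfies $g\ge n-\beta(n)+1$. If $\mathcal{B}$ is a $\kappa$-overlapping base sequence of $M$ and $n>2\left((2\kappa(n)+2\beta(n)+1)^2+\beta(n)\right)$, then $$t(\mathcal{B})\ge n-(2\kappa(n)+2\beta(n)+1)^2-\beta(n)-2.$$
   Context: Matroids are finite. The girth of a matroid is the size of a smallest circuit ($\infty$ if there are no circuits). A base sequence of a rank $n$ matroid $M$ is an $n$-tuple $\mathcal{B}=(B_1,\dots,B_n)$ of bases of $M$; the base $B_i$ is thought of as coloured with colour $i$. It is $\kappa$-overlapping if no element $e\in E(M)$ is contained in more than $\kappa(n)$ of the bases $B_1,\dots,B_n$ (counted by index). A rainbow base with respect to $\mathcal{B}$ is a base of $M$ containing exactly one element of each colour; precisely, it is given by a choice of representatives $b_c\in B_c$, $c=1,\dots,n$, that are distinct and such that $\{b_1,\dots,b_n\}$ is a base of $M$. Rainbow bases are said to be disjoint if for each colour $c$ their representatives of colour $c$ are distinct. $t(\mathcal{B})$ denotes the cardinality of a largest set of disjoint rainbow bases with respect to $\mathcal{B}$. *)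

theory Defs
  imports Complex_Main "HOL-Library.FuncSet" "HOL-Library.Extended_Nat"
    "HOL-Library.Landau_Symbols"
begin

locale matroid =
  fixes E :: "'a set" and indep :: "'a set \<Rightarrow> bool"
  assumes finite_ground: "finite E"
    and indep_subset_ground: "indep I \<Longrightarrow> I \<subseteq> E"
    and indep_empty: "indep {}"
    and indep_subset: "indep I \<Longrightarrow> J \<subseteq> I \<Longrightarrow> indep J"
    and augment: "indep I \<Longrightarrow> indep J \<Longrightarrow> card I < card J \<Longrightarrow> \<exists>x\<in>J - I. indep (insert x I)"
begin

definition base :: "'a set \<Rightarrow> bool" where
  "base B \<longleftrightarrow> indep B \<and> (\<forall>I. indep I \<longrightarrow> B \<subseteq> I \<longrightarrow> I = B)"

definition rank :: nat where
  "rank = Max (card ` {I. indep I})"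

definition circuit :: "'a set \<Rightarrow> bool" where
  "circuit C \<longleftrightarrow> C \<subseteq> E \<and> \<not> indep C \<and> (\<forall>D. D \<subset> C \<longrightarrow> indep D)"

text \<open>The infimum over the empty set is infinity, so a matroid without circuits has infinite girth.\<close>

definition girth :: enat where
  "girth = (INF C\<in>{C. circuit C}. enat (card C))"

text \<open>An n-tuple of bases is a function on the naturals, of which only the values at the colours
  1, ..., n matter, where n is the rank.\<close>

definition base_sequence :: "(nat \<Rightarrow> 'a set) \<Rightarrow> bool" where
  "base_sequence B \<longleftrightarrow> (\<forall>c\<in>{1..rank}. base (B c))"

definition overlapping :: "(nat \<Rightarrow> nat) \<Rightarrow> (nat \<Rightarrow> 'a set) \<Rightarrow> bool" where
  "overlapping \<kappa> B \<longleftrightarrow> (\<forall>e\<in>E. card {c\<in>{1..rank}. e \<in> B c} \<le> \<kappa> rank)"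

text \<open>A rainbow base is identified with its choice of representatives. The choice functions are
  extensional (undefined outside the set of colours), so that equal tuples of representatives
  are equal functions and cardinalities of sets of rainbow bases are meaningful.\<close>

definition rainbow_base :: "(nat \<Rightarrow> 'a set) \<Rightarrow> (nat \<Rightarrow> 'a) \<Rightarrow> bool" where
  "rainbow_base B b \<longleftrightarrow>
     b \<in> (\<Pi>\<^sub>E c\<in>{1..rank}. B c) \<and> inj_on b {1..rank} \<and> base (b ` {1..rank})"

text \<open>Disjointness is colour by colour: an element may occur in several disjoint rainbow bases,
  as long as it represents different colours there.\<close>

definition disjoint_rainbow_bases :: "(nat \<Rightarrow> 'a set) \<Rightarrow> (nat \<Rightarrow> 'a) set \<Rightarrow> bool" where
  "disjoint_rainbow_bases B S \<longleftrightarrow>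
     (\<forall>b\<in>S. rainbow_base B b) \<and> pairwise (\<lambda>b b'. \<forall>c\<in>{1..rank}. b c \<noteq> b' c) S"

definition max_disjoint_rainbow_bases :: "(nat \<Rightarrow> 'a set) \<Rightarrow> nat" where
  "max_disjoint_rainbow_bases B = Max {card S | S. disjoint_rainbow_bases B S}"

end

end

theory Submission
  imports Defs
begin

text \<open>Write \<open>n\<close> for the rank, and \<open>\<beta>\<close>, \<open>\<kappa>\<close> for the values of the two functions at \<open>n\<close>. Large girth
  enters only through the fact that every set of at most \<open>n - \<beta>\<close> elements is independent.

  Fix \<open>t\<close> and consider \<open>t\<close> pairwise disjoint partial rainbow independent sets
  \<open>S\<^sub>0, \<dots>, S\<^sub>t\<^sub>-\<^sub>1\<close>, chosen so that their sizes have the largest possible sum. Suppose that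
  some \<open>S\<^sub>j\<close> misses a colour. Two exchanges keep the total size.

  \<^item> Inside \<open>S\<^sub>j\<close>: an unused element \<open>x\<close> of the missing colour lies in the closure of \<open>S\<^sub>j\<close>, by
    maximality. If \<open>x\<close> is not an element of \<open>S\<^sub>j\<close>, it closes a circuit of more than \<open>n - \<beta>\<close>
    elements, and \<open>x\<close> may replace any other element of that circuit. So all but \<open>\<beta>\<close> colours can be made the
    missing colour of \<open>S\<^sub>j\<close> while its closure stays the same; these are the good colours
    (\<open>rank_le_card_good\<close>). If all unused elements already occur in \<open>S\<^sub>j\<close> under
    another colour, \<open>S\<^sub>j\<close> is first recoloured; the bound \<open>\<kappa>\<close> on multiplicities makes this possible.
  \<^item> Between two sets: if \<open>c\<close> is good and \<open>z\<close> is an element of \<open>B\<^sub>c\<close> outside the closure of \<open>S\<^sub>j\<close>, then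
    \<open>z\<close> must be in use with colour \<open>c\<close> in another set \<open>S\<^sub>i\<close>, since otherwise \<open>S\<^sub>j\<close> could be enlarged.
    Moving \<open>z\<close> to \<open>S\<^sub>j\<close> makes \<open>S\<^sub>i - z\<close> the deficient set (\<open>shift_deficiency\<close>).

  Repeated exchanges produce a finite set \<open>Q\<close> of deficient sets; let \<open>F\<close> be the intersection of
  their closures and \<open>p\<close> the corank \<open>n - r(F)\<close> of \<open>F\<close>. Count the pairs \<open>(c, z)\<close> with \<open>c\<close> good for every
  member of \<open>Q\<close> and \<open>z\<close> an element of \<open>B\<^sub>c\<close> outside \<open>F\<close>. Every such \<open>c\<close> has at least \<open>p\<close> of
  them. All of them are in use, and if no further exchange makes \<open>F\<close> smaller, then each set of the
  family contains at most \<open>p\<close> of them. As there are about \<open>n\<close> good colours and only \<open>t\<close> sets,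
  this is impossible when \<open>n - t\<close> exceeds a quadratic function of \<open>\<beta>\<close>; hence \<open>F\<close> can be made smaller
  as long as \<open>p \<le> \<beta>\<close> (\<open>extend_exchange_tree\<close>). Once \<open>p > \<beta>\<close>, large girth forces \<open>F\<close> to be a small
  set, so almost all elements of the good colours lie outside \<open>F\<close> and are in use, which is too many for
  \<open>t\<close> sets of at most \<open>n\<close> elements (\<open>no_deep_exchange_tree\<close>). So no set of the family is deficient:
  all are rainbow bases.\<close>

section \<open>Closures of independent sets in a matroid\<close>

context matroid
begin

lemma finite_indep: "indep I \<Longrightarrow> finite I"
  using indep_subset_ground finite_ground finite_subset by blast

lemma extend_indep:
  assumes "indep I" "indep J" "card I \<le> card J"
  shows "\<exists>I'. indep I' \<and> I \<subseteq> I' \<and> I' \<subseteq> I \<union> J \<and> card I' = card J"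
  using assms
proof (induction "card J - card I" arbitrary: I)
  case 0
  then show ?case by (intro exI[of _ I]) auto
next
  case (Suc d)
  then have "card I < card J" by simp
  then obtain x where x: "x \<in> J - I" "indep (insert x I)"
    using augment Suc.prems by blast
  have c: "card (insert x I) = Suc (card I)"
    using x finite_indep[OF Suc.prems(1)] by simp
  have "\<exists>I'. indep I' \<and> insert x I \<subseteq> I' \<and> I' \<subseteq> insert x I \<union> J \<and> card I' = card J"
    using Suc.hyps(1)[of "insert x I"] Suc.hyps(2) Suc.prems x c \<open>card I < card J\<close> by simp
  then show ?case using x by blast
qed

text \<open>The matroid closure for independent \<open>X\<close>. For dependent \<open>X\<close> the value is the whole ground set; only
  closures of independent sets occur below.\<close>

definition cl :: "'a set \<Rightarrow> 'a set" where
  "cl X = {x \<in> E. x \<in> X \<or> \<not> indep (insert x X)}"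

lemma cl_subset_ground: "cl X \<subseteq> E"
  by (auto simp: cl_def)

lemma subset_cl: "indep S \<Longrightarrow> S \<subseteq> cl S"
  using indep_subset_ground by (auto simp: cl_def)

lemma card_indep_in_cl:
  assumes "indep S" "indep I" "I \<subseteq> cl S"
  shows "card I \<le> card S"
proof (rule ccontr)
  assume "\<not> card I \<le> card S"
  then obtain x where "x \<in> I - S" "indep (insert x S)"
    using augment assms by (meson not_le)
  then show False using assms(3) by (auto simp: cl_def)
qed

text \<open>Closures of independent sets are flats. Augment \<open>I\<close> from \<open>insert z S\<close> to size \<open>card S + 1\<close>: the
  result is too large to lie in \<open>cl S\<close>, so \<open>z\<close> was added on the way.\<close>

lemma indep_insert_outside_cl:
  assumes S: "indep S" and I: "indep I" "I \<subseteq> cl S" and z: "z \<in> E" "z \<notin> cl S"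
  shows "indep (insert z I)"
proof -
  have zS: "z \<notin> S" "indep (insert z S)" using z by (auto simp: cl_def)
  have cz: "card (insert z S) = Suc (card S)" using zS finite_indep[OF S] by simp
  have "card I \<le> card (insert z S)"
    using card_indep_in_cl[OF S I] cz by simp
  then obtain I' where I': "indep I'" "I \<subseteq> I'" "I' \<subseteq> I \<union> insert z S" "card I' = Suc (card S)"
    using extend_indep[OF I(1) zS(2)] cz by auto
  have "z \<in> I'"
  proof (rule ccontr)
    assume "z \<notin> I'"
    then have "I' \<subseteq> cl S" using I' I(2) subset_cl[OF S] by blast
    then show False using card_indep_in_cl[OF S I'(1)] I'(4) by simp
  qed
  then show ?thesis using I' indep_subset by blast
qed

lemma cl_eq_of_card_eq:
  assumes S: "indep S" and S': "indep S'" "S' \<subseteq> cl S" "card S' = card S"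
  shows "cl S' = cl S"
proof
  show "cl S' \<subseteq> cl S"
  proof
    fix z assume z: "z \<in> cl S'"
    show "z \<in> cl S"
    proof (rule ccontr)
      assume n: "z \<notin> cl S"
      have "z \<in> E" using z cl_subset_ground by blast
      then have "indep (insert z S')" using indep_insert_outside_cl[OF S S'(1,2)] n by blast
      then show False using z n S'(2) by (auto simp: cl_def)
    qed
  qed
  show "cl S \<subseteq> cl S'"
  proof
    fix z assume z: "z \<in> cl S"
    show "z \<in> cl S'"
    proof (rule ccontr)
      assume n: "z \<notin> cl S'"
      then have i: "z \<notin> S'" "indep (insert z S')" using z by (auto simp: cl_def)
      have "card (insert z S') \<le> card S"
        using card_indep_in_cl[OF S i(2)] z S'(2) by blast
      then show False using i finite_indep[OF S'(1)] S'(3) by simp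
    qed
  qed
qed

definition rk :: "'a set \<Rightarrow> nat" where
  "rk X = Max (card ` {I. indep I \<and> I \<subseteq> X})"

lemma finite_indeps: "finite {I. indep I \<and> P I}"
  by (rule finite_subset[of _ "Pow E"]) (use indep_subset_ground finite_ground in auto)

lemma card_le_rk: "indep I \<Longrightarrow> I \<subseteq> X \<Longrightarrow> card I \<le> rk X"
  unfolding rk_def by (rule Max_ge) (auto simp: finite_indeps)

lemma rk_witness:
  obtains I where "indep I" "I \<subseteq> X" "card I = rk X"
proof -
  have "rk X \<in> card ` {I. indep I \<and> I \<subseteq> X}"
    unfolding rk_def by (rule Max_in) (use finite_indeps indep_empty in auto)
  then show ?thesis using that by auto
qed

lemma card_le_rank: "indep I \<Longrightarrow> card I \<le> rank"
  unfolding rank_def using finite_indeps[of "\<lambda>_. True"] by (intro Max_ge) auto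

lemma rank_witness: obtains I where "indep I" "card I = rank"
proof -
  have "rank \<in> card ` {I. indep I}"
    unfolding rank_def by (rule Max_in) (use finite_indeps[of "\<lambda>_. True"] indep_empty in auto)
  then show ?thesis using that by auto
qed

lemma base_iff: "base X \<longleftrightarrow> indep X \<and> card X = rank"
proof
  assume b: "base X"
  obtain I where I: "indep I" "card I = rank" by (rule rank_witness)
  have X: "indep X" using b by (simp add: base_def)
  obtain X' where "indep X'" "X \<subseteq> X'" "card X' = rank"
    using extend_indep[OF X I(1)] card_le_rank[OF X] I(2) by auto
  then show "indep X \<and> card X = rank" using b X by (auto simp: base_def)
next
  assume X: "indep X \<and> card X = rank"
  have "I = X" if "indep I" "X \<subseteq> I" for I
    using card_subset_eq[OF finite_indep[OF that(1)] that(2)] card_le_rank[OF that(1)]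
      card_mono[OF finite_indep[OF that(1)] that(2)] X by simp
  then show "base X" using X by (simp add: base_def)
qed

lemma rk_inter_cl_less:
  assumes S: "indep S" and X: "X \<subseteq> E" "\<not> X \<subseteq> cl S"
  shows "rk (X \<inter> cl S) < rk X"
proof -
  obtain z where z: "z \<in> X" "z \<notin> cl S" using X by blast
  obtain I where I: "indep I" "I \<subseteq> X \<inter> cl S" "card I = rk (X \<inter> cl S)" by (rule rk_witness)
  have "indep (insert z I)"
    using indep_insert_outside_cl[OF S I(1)] I z X by blast
  then have "card (insert z I) \<le> rk X" using card_le_rk I z by auto
  moreover have "card (insert z I) = Suc (card I)"
    using I z finite_indep[OF I(1)] by (auto simp: card_insert_if)
  ultimately show ?thesis using I(3) by simp
qed

text \<open>The closures of the sets \<open>S - {z}\<close> with \<open>z\<close> in \<open>R\<close> meet in the closure of \<open>S - R\<close>, whose corank is at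
  least the size of \<open>R\<close>. To see the bound, take an independent subset \<open>I\<close> of \<open>X\<close> of full rank and add the
  elements of \<open>R\<close> one at a time: each \<open>z\<close> is outside \<open>cl (S - {z})\<close>, which contains \<open>I\<close> and the part of
  \<open>R\<close> added so far.\<close>

lemma rk_add_card_le_rank:
  assumes S: "indep S" and R: "R \<subseteq> S" and X: "\<And>z. z \<in> R \<Longrightarrow> X \<subseteq> cl (S - {z})"
  shows "card R + rk X \<le> rank"
proof -
  obtain I where I: "indep I" "I \<subseteq> X" "card I = rk X" by (rule rk_witness)
  have fR: "finite R" using R finite_indep[OF S] finite_subset by blast
  have "indep (R \<union> I) \<and> card (R \<union> I) = card R + card I" using fR R X
  proof (induction R rule: finite_induct)
    case empty
    then show ?case using I by simp
  next
    case (insert z R)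
    let ?T = "S - {z}"
    have T: "indep ?T" using S indep_subset by blast
    have z: "z \<in> S" "z \<in> E" using insert.prems indep_subset_ground[OF S] by auto
    have zcl: "z \<notin> cl ?T" using S z by (auto simp: cl_def insert_absorb)
    have sub: "R \<union> I \<subseteq> cl ?T"
      using insert subset_cl[OF T] I(2) by blast
    have IH: "indep (R \<union> I) \<and> card (R \<union> I) = card R + card I"
      using insert by simp
    have "indep (insert z (R \<union> I))"
      using indep_insert_outside_cl[OF T _ sub z(2) zcl] IH by simp
    moreover have "card (insert z (R \<union> I)) = Suc (card (R \<union> I))"
      using sub zcl IH finite_indep[of "R \<union> I"] by (auto simp: card_insert_if)
    ultimately show ?case using IH insert.hyps by simp
  qed
  then show ?thesis using card_le_rank I(3) by fastforce
qed

lemma exists_circuit: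
  assumes "X \<subseteq> E" "\<not> indep X"
  shows "\<exists>C. circuit C \<and> C \<subseteq> X"
proof -
  have fin: "finite X" using assms finite_ground finite_subset by blast
  show ?thesis using fin assms
  proof (induction X rule: finite_psubset_induct)
    case (psubset X)
    show ?case
    proof (cases "\<forall>D. D \<subset> X \<longrightarrow> indep D")
      case True
      then show ?thesis using psubset.prems unfolding circuit_def by blast
    next
      case False
      then obtain D where D: "D \<subset> X" "\<not> indep D" by blast
      have "\<exists>C. circuit C \<and> C \<subseteq> D"
        by (rule psubset.IH) (use D psubset.prems in auto)
      then show ?thesis using D by blast
    qed
  qed
qed

lemma indep_of_card_lt_girth:
  assumes "X \<subseteq> E" "enat (card X) < girth"
  shows "indep X"
proof (rule ccontr)
  assume "\<not> indep X"
  then obtain C where C: "circuit C" "C \<subseteq> X" using exists_circuit assms by blast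
  have "girth \<le> enat (card C)" unfolding girth_def using C by (auto intro: INF_lower)
  also have "\<dots> \<le> enat (card X)"
    using card_mono[OF _ C(2)] assms finite_ground finite_subset by auto
  finally show False using assms by simp
qed

text \<open>The set \<open>C - {y}\<close> can be augmented from \<open>S\<close> to an independent set of size \<open>card S\<close>, which cannot contain \<open>y\<close> and is therefore all of \<open>insert x (S - {y})\<close>.\<close>

lemma circuit_exchange:
  assumes S: "indep S" and C: "circuit C" "C \<subseteq> insert x S" and y: "y \<in> C" "y \<noteq> x"
  shows "indep (insert x (S - {y}))"
proof -
  have fS: "finite S" using finite_indep[OF S] .
  have depC: "\<not> indep C" and Cy: "indep (C - {y})"
    using C(1) y(1) unfolding circuit_def by auto
  have yS: "y \<in> S" using C(2) y by blast
  have xS: "x \<notin> S"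
  proof
    assume "x \<in> S"
    then have "C \<subseteq> S" using C(2) by blast
    then show False using depC indep_subset[OF S] by blast
  qed
  have card_swap: "card (insert x (S - {y})) = card S"
    using xS card.remove[OF fS yS] fS by simp
  have Csub: "C - {y} \<subseteq> insert x (S - {y})" using C(2) by blast
  then have "card (C - {y}) \<le> card S"
    using card_mono[OF _ Csub] fS card_swap by simp
  then obtain I where I: "indep I" "C - {y} \<subseteq> I" "I \<subseteq> (C - {y}) \<union> S" "card I = card S"
    using extend_indep[OF Cy S] by blast
  have "y \<notin> I"
  proof
    assume "y \<in> I"
    then have "C \<subseteq> I" using I(2) by blast
    then show False using indep_subset[OF I(1)] depC by blast
  qed
  then have sub: "I \<subseteq> insert x (S - {y})" using I(3) C(2) by blast
  have "I = insert x (S - {y})"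
    using card_subset_eq[OF _ sub] fS I(4) card_swap by simp
  then show ?thesis using I(1) by simp
qed

end

section \<open>Recolouring a rainbow set\<close>

text \<open>A partial colouring \<open>f\<close> of the set \<open>X\<close> misses the single colour \<open>b\<close> of \<open>D\<close>. Giving the colour \<open>b\<close> to
  the element of colour \<open>d\<close>, where this element is in the palette of \<open>b\<close>, makes \<open>d\<close> the missing colour. If no sequence of such moves
  ever lets a missing colour see an element outside \<open>X\<close>, then the colours that can become the
  missing one form a set \<open>R\<close> whose palettes use only elements of \<open>X\<close> coloured from \<open>R\<close>.

  The set \<open>V\<close> of colours that may still be moved serves the induction: after a first
  move \<open>b \<leftarrow> d\<close> the colour \<open>d\<close> is withdrawn from \<open>V\<close>, so that on the remaining \<open>V\<close> the new colouring agrees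
  with \<open>f\<close>, and closed sets for the new colouring are closed for \<open>f\<close>.\<close>

lemma exists_closed_colour_set:
  fixes A :: "'c \<Rightarrow> 'a set" and f :: "'c \<Rightarrow> 'a option"
  assumes stuck: "\<And>g c. inj_on g (dom g) \<Longrightarrow> \<forall>c x. g c = Some x \<longrightarrow> x \<in> A c \<Longrightarrow> ran g = X \<Longrightarrow>
      c \<in> D \<Longrightarrow> dom g = D - {c} \<Longrightarrow> A c \<subseteq> X"
    and "finite V" "V \<subseteq> dom f" "inj_on f (dom f)" "\<forall>c x. f c = Some x \<longrightarrow> x \<in> A c"
    "ran f = X" "b \<in> D" "dom f = D - {b}"
  shows "\<exists>R. b \<in> R \<and> R \<subseteq> insert b V \<and> (\<forall>c\<in>R. A c \<subseteq> X)
            \<and> (\<forall>c\<in>R. \<forall>d\<in>V. \<forall>x\<in>A c. f d = Some x \<longrightarrow> d \<in> R)"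
  using assms(2-)
proof (induction "card V" arbitrary: V f b rule: less_induct)
  case less
  have fb: "f b = None" using less.prems(7) by blast
  have Ab: "A b \<subseteq> X" using stuck[OF less.prems(3-7)] .
  define V' where "V' = {d \<in> V. \<exists>x \<in> A b. f d = Some x}"
  define P where "P d R \<longleftrightarrow> d \<in> R \<and> R \<subseteq> V \<and> (\<forall>c\<in>R. A c \<subseteq> X)
          \<and> (\<forall>c\<in>R. \<forall>e\<in>V. \<forall>x\<in>A c. f e = Some x \<longrightarrow> e \<in> R)" for d R
  have ex: "\<exists>R. P d R" if d: "d \<in> V'" for d
  proof -
    obtain x where x: "x \<in> A b" "f d = Some x" and dV: "d \<in> V"
      using d unfolding V'_def by blast
    have db: "d \<noteq> b" using x(2) fb by fastforce
    have dD: "d \<in> D" using x(2) less.prems(7) by blast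
    define g where "g = f(b := Some x, d := None)"
    have g: "g b = Some x" "g d = None" "\<And>e. e \<noteq> b \<Longrightarrow> e \<noteq> d \<Longrightarrow> g e = f e"
      using db by (simp_all add: g_def)
    have domg: "dom g = D - {d}"
      using db dD less.prems(6,7) unfolding g_def dom_fun_upd by simp blast
    have uniq: "e = d" if "f e = Some x" for e
      using less.prems(3) x(2) that by (metis domI inj_onD)
    have rang: "ran g = X"
    proof -
      have "(\<exists>e. g e = Some y) \<longleftrightarrow> (\<exists>e. f e = Some y)" for y
      proof
        assume "\<exists>e. g e = Some y"
        then obtain e where e: "g e = Some y" ..
        show "\<exists>e. f e = Some y"
          using e g x(2) by (cases "e = b"; cases "e = d") auto
      next
        assume "\<exists>e. f e = Some y"
        then obtain e where e: "f e = Some y" ..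
        show "\<exists>e. g e = Some y"
        proof (cases "e = d")
          case True
          then show ?thesis using e x(2) g(1) by auto
        next
          case False
          moreover have "e \<noteq> b" using e fb by auto
          ultimately have "g e = Some y" using e g(3) by simp
          then show ?thesis by blast
        qed
      qed
      then have "ran g = ran f" by (simp add: ran_def)
      then show ?thesis using less.prems(5) by simp
    qed
    have injg: "inj_on g (dom g)"
    proof (rule inj_onI)
      fix u v assume uv: "u \<in> dom g" "v \<in> dom g" "g u = g v"
      have ud: "u \<noteq> d" "v \<noteq> d" using uv domg by blast+
      have nx: "f w \<noteq> Some x" if "w \<noteq> d" for w using uniq that by blast
      show "u = v"
      proof (cases "u = b \<or> v = b")
        case True
        then show ?thesis using uv(3) ud nx g by metis
      next
        case False
        then have "f u = f v" "u \<in> dom f" "v \<in> dom f"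
          using uv ud g(3) domg less.prems(7) by auto
        then show ?thesis using less.prems(3) by (meson inj_onD)
      qed
    qed
    have valg: "\<forall>c y. g c = Some y \<longrightarrow> y \<in> A c"
    proof (intro allI impI)
      fix c y assume "g c = Some y"
      then show "y \<in> A c"
        using less.prems(4) x(1) g by (cases "c = b"; cases "c = d") auto
    qed
    have "\<exists>R. d \<in> R \<and> R \<subseteq> insert d (V - {d}) \<and> (\<forall>c\<in>R. A c \<subseteq> X)
          \<and> (\<forall>c\<in>R. \<forall>e\<in>V - {d}. \<forall>x\<in>A c. g e = Some x \<longrightarrow> e \<in> R)"
    proof (rule less.hyps[OF _ _ _ injg valg rang dD domg])
      show "card (V - {d}) < card V" using dV less.prems(1) by (meson card_Diff1_less)
      show "finite (V - {d})" using less.prems(1) by simp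
      show "V - {d} \<subseteq> dom g" using less.prems(2,7) domg by blast
    qed
    then obtain R where R: "d \<in> R" "R \<subseteq> insert d (V - {d})" "\<forall>c\<in>R. A c \<subseteq> X"
      "\<forall>c\<in>R. \<forall>e\<in>V - {d}. \<forall>x\<in>A c. g e = Some x \<longrightarrow> e \<in> R"
      by blast
    have "e \<in> R" if e: "c \<in> R" "e \<in> V" "y \<in> A c" "f e = Some y" for c e y
    proof (cases "e = d")
      case False
      have "e \<noteq> b" using e(4) fb by auto
      then have "g e = Some y" using e(4) False g(3) by simp
      then show ?thesis using R(4) e(1-3) False by blast
    next
      case True
      then show ?thesis using R(1) by simp
    qed
    moreover have "R \<subseteq> V" using R(2) dV by blast
    ultimately show ?thesis using R(1,3) unfolding P_def by (intro exI[of _ R] conjI ballI impI) blast+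
  qed
  then have "\<forall>d\<in>V'. \<exists>R. P d R" by blast
  from bchoice[OF this] obtain R where PR: "\<forall>d\<in>V'. P d (R d)" by blast
  have R: "d \<in> R d" "R d \<subseteq> V" "\<forall>c\<in>R d. A c \<subseteq> X"
      "\<forall>c\<in>R d. \<forall>e\<in>V. \<forall>x\<in>A c. f e = Some x \<longrightarrow> e \<in> R d" if "d \<in> V'" for d
    using bspec[OF PR that] unfolding P_def by - (elim conjE; assumption)+
  let ?R = "insert b (\<Union>d\<in>V'. R d)"
  show ?case
  proof (intro exI[of _ ?R] conjI ballI impI)
    show "b \<in> ?R" by simp
    show "?R \<subseteq> insert b V" using R(2) by blast
    show "A c \<subseteq> X" if "c \<in> ?R" for c
      using that Ab R(3) by blast
    show "e \<in> ?R" if ce: "c \<in> ?R" "e \<in> V" "x \<in> A c" "f e = Some x" for c e x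
    proof (cases "c = b")
      case True
      then have "e \<in> V'" using ce unfolding V'_def by blast
      then show ?thesis using R(1) by blast
    next
      case False
      then obtain d where d: "d \<in> V'" "c \<in> R d" using ce(1) by blast
      then have "e \<in> R d" using R(4) ce by blast
      then show ?thesis using d by blast
    qed
  qed
qed


section \<open>Rainbow sets under large girth and bounded overlap\<close>

lemma sum_card_Int_le:
  assumes "finite R" "finite Y" "\<And>x. x \<in> Y \<Longrightarrow> card {c \<in> R. x \<in> A c} \<le> k"
  shows "(\<Sum>c\<in>R. card (A c \<inter> Y)) \<le> k * card Y"
proof -
  have "A c \<inter> Y = {x \<in> Y. x \<in> A c}" for c by blast
  then have "(\<Sum>c\<in>R. card (A c \<inter> Y)) = (\<Sum>c\<in>R. card {x \<in> Y. x \<in> A c})" by simp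
  also have "\<dots> = (\<Sum>x\<in>Y. card {c \<in> R. x \<in> A c})"
    by (rule sum_multicount_gen) (use assms in auto)
  also have "\<dots> \<le> of_nat (card Y) * k" by (rule sum_bounded_above) (use assms in auto)
  finally show ?thesis by (simp add: mult.commute)
qed

lemma card_ran_eq_card_dom:
  assumes "inj_on f (dom f)"
  shows "card (ran f) = card (dom f)"
proof -
  have "ran f = (\<lambda>c. the (f c)) ` dom f" by (force simp: ran_def)
  moreover have "inj_on (\<lambda>c. the (f c)) (dom f)"
  proof (rule inj_onI)
    fix c d assume "c \<in> dom f" "d \<in> dom f" "the (f c) = the (f d)"
    then have "f c = f d" by (metis domIff option.expand)
    then show "c = d" using assms \<open>c \<in> dom f\<close> \<open>d \<in> dom f\<close> by (meson inj_onD)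
  qed
  ultimately show ?thesis by (simp add: card_image)
qed

lemma ran_remove:
  assumes "inj_on f (dom f)" "f c = Some x"
  shows "ran (f(c := None)) = ran f - {x}"
proof -
  have other: "d \<noteq> c \<Longrightarrow> f d \<noteq> Some x" for d
    using assms by (metis domI inj_onD)
  have "ran (f(c := None)) = {y. \<exists>d. d \<noteq> c \<and> f d = Some y}"
    unfolding ran_def by (auto split: if_splits)
  also have "{y. \<exists>d. d \<noteq> c \<and> f d = Some y} = {y. \<exists>d. f d = Some y} - {x}"
  proof -
    have "(\<exists>d. d \<noteq> c \<and> f d = Some y) \<longleftrightarrow> (\<exists>d. f d = Some y) \<and> y \<noteq> x" for y
      using other assms(2) by (metis option.inject)
    then show ?thesis by auto
  qed
  finally show ?thesis unfolding ran_def .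
qed

locale high_girth_base_sequence = matroid E indep
  for E :: "'a set" and indep +
  fixes B :: "nat \<Rightarrow> 'a set" and \<beta> \<kappa> :: nat
  assumes bases: "base_sequence B"
    and small_indep: "X \<subseteq> E \<Longrightarrow> card X + \<beta> \<le> rank \<Longrightarrow> indep X"
    and overlap: "e \<in> E \<Longrightarrow> card {c \<in> {1..rank}. e \<in> B c} \<le> \<kappa>"
begin

lemma indep_B: "c \<in> {1..rank} \<Longrightarrow> indep (B c)"
  and card_B: "c \<in> {1..rank} \<Longrightarrow> card (B c) = rank"
  using bases base_iff by (auto simp: base_sequence_def)

lemma B_subset_ground: "c \<in> {1..rank} \<Longrightarrow> B c \<subseteq> E"
  using indep_B indep_subset_ground by blast

lemma finite_B: "c \<in> {1..rank} \<Longrightarrow> finite (B c)"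
  using indep_B finite_indep by blast

definition rainbow :: "(nat \<Rightarrow> 'a set) \<Rightarrow> (nat \<Rightarrow> 'a option) \<Rightarrow> bool" where
  "rainbow A f \<longleftrightarrow> dom f \<subseteq> {1..rank} \<and> inj_on f (dom f)
     \<and> (\<forall>c x. f c = Some x \<longrightarrow> x \<in> A c) \<and> indep (ran f)"

lemma rainbowD:
  assumes "rainbow A f"
  shows "dom f \<subseteq> {1..rank}" "inj_on f (dom f)" "f c = Some x \<Longrightarrow> x \<in> A c" "indep (ran f)"
    "finite (dom f)" "card (ran f) = card (dom f)"
  using assms finite_subset[of "dom f" "{1..rank}"] card_ran_eq_card_dom[of f]
  unfolding rainbow_def by auto

lemma rainbow_remove:
  assumes "rainbow A f"
  shows "rainbow A (f(c := None))"
proof -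
  have "ran (f(c := None)) \<subseteq> ran f" by (auto simp: ran_def)
  then have "indep (ran (f(c := None)))" using rainbowD(4)[OF assms] indep_subset by blast
  moreover have "inj_on (f(c := None)) (dom (f(c := None)))"
    using rainbowD(2)[OF assms] by (auto simp: inj_on_def)
  ultimately show ?thesis using assms unfolding rainbow_def by auto
qed

lemma rainbow_insert:
  assumes f: "rainbow A f" and c: "c \<in> {1..rank}" "f c = None"
    and x: "x \<in> A c" "x \<notin> ran f" "indep (insert x (ran f))"
  shows "rainbow A (f(c \<mapsto> x))"
proof -
  have new: "f d \<noteq> Some x" for d using x(2) by (auto simp: ran_def)
  have "inj_on (f(c \<mapsto> x)) (dom (f(c \<mapsto> x)))"
  proof (rule inj_onI)
    fix u v assume uv: "u \<in> dom (f(c \<mapsto> x))" "v \<in> dom (f(c \<mapsto> x))" "(f(c \<mapsto> x)) u = (f(c \<mapsto> x)) v"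
    show "u = v"
    proof (cases "u = c \<or> v = c")
      case True
      then show ?thesis using uv(3) new by (metis fun_upd_apply)
    next
      case False
      then show ?thesis using uv rainbowD(2)[OF f] by (auto dest: inj_onD)
    qed
  qed
  moreover have "indep (ran (f(c \<mapsto> x)))" using c x by simp
  ultimately show ?thesis using f c x unfolding rainbow_def by auto
qed

lemma rainbow_mono: "rainbow A f \<Longrightarrow> (\<And>c. A c \<subseteq> A' c) \<Longrightarrow> rainbow A' f"
  unfolding rainbow_def by blast

text \<open>Otherwise \<open>exists_closed_colour_set\<close> gives a set \<open>R\<close> of colours whose palettes together have at most
  \<open>card R\<close> elements. Each palette has more than \<open>\<kappa>\<close> elements, and each element is in at most
  \<open>\<kappa>\<close> palettes, so counting incidences gives a contradiction.\<close>

lemma exists_recolouring_with_new_element: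
  assumes A: "\<And>c. c \<in> {1..rank} \<Longrightarrow> A c \<subseteq> B c \<and> \<kappa> < card (A c)"
    and f: "rainbow A f" and b: "b \<in> {1..rank}" "f b = None"
  shows "\<exists>g c. rainbow A g \<and> ran g = ran f \<and> c \<in> {1..rank} \<and> g c = None \<and> \<not> A c \<subseteq> ran f"
proof (rule ccontr)
  assume none: "\<not> ?thesis"
  let ?D = "insert b (dom f)"
  have D: "?D \<subseteq> {1..rank}" using rainbowD(1)[OF f] b by blast
  have stuck: "A c \<subseteq> ran f" if "inj_on g (dom g)" "\<forall>c x. g c = Some x \<longrightarrow> x \<in> A c"
    "ran g = ran f" "c \<in> ?D" "dom g = ?D - {c}" for g c
  proof -
    have "rainbow A g" using that D rainbowD(4)[OF f] unfolding rainbow_def by auto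
    moreover have "g c = None" using that(5) by blast
    moreover have "c \<in> {1..rank}" using that(4) D by blast
    ultimately show ?thesis using none that(3) by blast
  qed
  have domf: "dom f = ?D - {b}" using b(2) by blast
  have valf: "\<forall>c x. f c = Some x \<longrightarrow> x \<in> A c" using rainbowD(3)[OF f] by blast
  have "\<exists>R. b \<in> R \<and> R \<subseteq> insert b (dom f) \<and> (\<forall>c\<in>R. A c \<subseteq> ran f)
      \<and> (\<forall>c\<in>R. \<forall>d\<in>dom f. \<forall>x\<in>A c. f d = Some x \<longrightarrow> d \<in> R)"
  proof (rule exists_closed_colour_set[where f = f and D = ?D])
    show "A c \<subseteq> ran f" if "inj_on g (dom g)" "\<forall>c x. g c = Some x \<longrightarrow> x \<in> A c"
      "ran g = ran f" "c \<in> ?D" "dom g = ?D - {c}" for g c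
      by (rule stuck[OF that])
    show "\<forall>c x. f c = Some x \<longrightarrow> x \<in> A c" by (fact valf)
    show "dom f = ?D - {b}" by (fact domf)
  qed (use rainbowD(2,5)[OF f] in simp_all)
  then obtain R where R: "b \<in> R" "R \<subseteq> ?D" "\<forall>c\<in>R. A c \<subseteq> ran f"
    "\<forall>c\<in>R. \<forall>d\<in>dom f. \<forall>x\<in>A c. f d = Some x \<longrightarrow> d \<in> R"
    by (elim exE conjE) (rule that)
  have RD: "R \<subseteq> {1..rank}" using R(2) D by blast
  then have fR: "finite R" using finite_subset by blast
  let ?Y = "\<Union>c\<in>R. A c"
  have Ysub: "?Y \<subseteq> (\<lambda>d. the (f d)) ` R"
  proof
    fix x assume "x \<in> ?Y"
    then obtain c where c: "c \<in> R" "x \<in> A c" by blast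
    then obtain d where d: "f d = Some x" using R(3) by (auto simp: ran_def)
    then have "d \<in> R" using R(4) c by blast
    then show "x \<in> (\<lambda>d. the (f d)) ` R" using d by force
  qed
  have fY: "finite ?Y" using finite_subset[OF Ysub] fR by simp
  have cY: "card ?Y \<le> card R" using surj_card_le[OF fR Ysub] .
  have "card {c \<in> R. x \<in> A c} \<le> \<kappa>" if x: "x \<in> ?Y" for x
  proof -
    have "x \<in> E" using x RD A B_subset_ground by blast
    have "{c \<in> R. x \<in> A c} \<subseteq> {c \<in> {1..rank}. x \<in> B c}" using RD A by blast
    then have "card {c \<in> R. x \<in> A c} \<le> card {c \<in> {1..rank}. x \<in> B c}"
      by (intro card_mono) auto
    also have "\<dots> \<le> \<kappa>" using overlap \<open>x \<in> E\<close> .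
    finally show ?thesis .
  qed
  then have le: "(\<Sum>c\<in>R. card (A c \<inter> ?Y)) \<le> \<kappa> * card ?Y"
    by (intro sum_card_Int_le fR fY)
  have "Suc \<kappa> * card R \<le> (\<Sum>c\<in>R. card (A c \<inter> ?Y))"
  proof -
    have "Suc \<kappa> \<le> card (A c \<inter> ?Y)" if "c \<in> R" for c
    proof -
      have "A c \<inter> ?Y = A c" using that by blast
      then show ?thesis using A[of c] that RD by auto
    qed
    then have "of_nat (card R) * Suc \<kappa> \<le> (\<Sum>c\<in>R. card (A c \<inter> ?Y))"
      by (intro sum_bounded_below) auto
    then show ?thesis by (simp add: mult.commute)
  qed
  also have "\<dots> \<le> \<kappa> * card R" using le cY by (meson le_trans mult_le_mono2)
  finally have "card R = 0" by simp
  then show False using R(1) fR by auto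
qed

text \<open>After a recolouring that leaves the set of elements unchanged, some missing colour \<open>a\<close> has an element \<open>x\<close> in
  its palette that is not in the rainbow set. By maximality \<open>x\<close> closes a circuit, which has more than
  \<open>n - \<beta>\<close> elements, and the colour of every other element of this circuit can be freed in favour of
  \<open>x\<close>. The rainbow set then changes only within its closure.\<close>

lemma many_missable_colours:
  assumes A: "\<And>c. c \<in> {1..rank} \<Longrightarrow> A c \<subseteq> B c \<and> \<kappa> < card (A c)"
    and f: "rainbow A f" and maximal: "\<And>g. rainbow A g \<Longrightarrow> card (dom g) \<le> card (dom f)"
    and b: "b \<in> {1..rank}" "f b = None"
  shows "rank \<le> card {c \<in> {1..rank}. \<exists>g. rainbow A g \<and> card (dom g) = card (dom f)
     \<and> cl (ran g) = cl (ran f) \<and> g c = None} + \<beta>" (is "_ \<le> card ?M + _")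
proof -
  obtain g a where g: "rainbow A g" "ran g = ran f" and a: "a \<in> {1..rank}" "g a = None" "\<not> A a \<subseteq> ran f"
    using exists_recolouring_with_new_element[OF A f b] by blast
  then obtain x where x: "x \<in> A a" "x \<notin> ran g" by blast
  have cg: "card (dom g) = card (dom f)"
    using rainbowD(6)[OF g(1)] rainbowD(6)[OF f] g(2) by simp
  note gD = rainbowD[OF g(1)]
  have dep: "\<not> indep (insert x (ran g))"
  proof
    assume "indep (insert x (ran g))"
    then have "rainbow A (g(a \<mapsto> x))" using rainbow_insert g a x by blast
    then have "card (insert a (dom g)) \<le> card (dom f)" using maximal[of "g(a \<mapsto> x)"] by simp
    then show False using a(2) gD(5) cg by (auto simp: card_insert_if domIff)
  qed
  have xE: "x \<in> E" using x a A B_subset_ground by blast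
  then have xcl: "x \<in> cl (ran g)" using dep by (simp add: cl_def)
  have "insert x (ran g) \<subseteq> E" using xE indep_subset_ground[OF gD(4)] by blast
  then obtain C where C: "circuit C" "C \<subseteq> insert x (ran g)" using exists_circuit dep by blast
  have CE: "C \<subseteq> E" and depC: "\<not> indep C" using C(1) by (auto simp: circuit_def)
  have finC: "finite C" using CE finite_ground finite_subset by blast
  have cC: "rank < card C + \<beta>" using small_indep[OF CE] depC by (meson not_le)
  let ?K = "{d \<in> dom g. the (g d) \<in> C - {x}}"
  have "C - {x} \<subseteq> (\<lambda>d. the (g d)) ` ?K"
  proof
    fix y assume y: "y \<in> C - {x}"
    then have "y \<in> ran g" using C(2) by blast
    then obtain d where "g d = Some y" by (auto simp: ran_def)
    then show "y \<in> (\<lambda>d. the (g d)) ` ?K" using y by force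
  qed
  moreover have "finite ?K" using gD(5) by simp
  ultimately have "card (C - {x}) \<le> card ?K" by (intro surj_card_le)
  moreover have "card C \<le> card (C - {x}) + 1"
    using finC by (auto simp add: card_Diff_singleton_if)
  moreover have "?K \<subseteq> ?M"
  proof
    fix d assume d: "d \<in> ?K"
    then obtain y where y: "g d = Some y" "y \<in> C" "y \<noteq> x" by auto
    let ?h = "g(d := None)" and ?h' = "(g(d := None))(a \<mapsto> x)"
    have da: "d \<noteq> a" using y(1) a(2) by auto
    have rh: "ran ?h = ran g - {y}" using ran_remove[OF gD(2) y(1)] .
    have ind: "indep (insert x (ran g - {y}))" using circuit_exchange[OF gD(4) C y(2,3)] .
    have h: "rainbow A ?h'"
      by (rule rainbow_insert[OF rainbow_remove[OF g(1)]]) (use a x rh ind in auto)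
    have rh': "ran ?h' = insert x (ran g - {y})"
      using a(2) rh by (subst ran_map_upd) auto
    have "card (insert x (ran g - {y})) = card (ran g)"
    proof -
      have "y \<in> ran g" using y(1) by (rule ranI)
      then show ?thesis using x(2) finite_indep[OF gD(4)] card.remove[of "ran g" y] by simp
    qed
    then have "card (ran ?h') = card (ran g)" using rh' by simp
    then have "cl (ran ?h') = cl (ran g)" "card (dom ?h') = card (dom f)"
      using cl_eq_of_card_eq[OF gD(4) rainbowD(4)[OF h]] rh' xcl subset_cl[OF gD(4)]
        rainbowD(6)[OF h] gD(6) cg by auto
    moreover have "?h' d = None" using da by simp
    moreover have "d \<in> {1..rank}" using d gD(1) by blast
    ultimately show "d \<in> ?M" using h g(2) by (intro CollectI conjI exI[of _ ?h']) simp_all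
  qed
  then have "card ?K \<le> card ?M" by (intro card_mono) auto
  ultimately show ?thesis using cC by linarith
qed

section \<open>Optimal families and exchanges between their members\<close>

text \<open>A family of \<open>t\<close> partial rainbow sets is given by partial maps from colours to elements; the values of
  \<open>S\<close> at indices from \<open>t\<close> on are irrelevant. Disjointness is colour by colour, as for rainbow bases.\<close>

definition family :: "nat \<Rightarrow> (nat \<Rightarrow> nat \<Rightarrow> 'a option) \<Rightarrow> bool" where
  "family t S \<longleftrightarrow> (\<forall>i<t. rainbow B (S i))
     \<and> (\<forall>i<t. \<forall>j<t. i \<noteq> j \<longrightarrow> (\<forall>c x. S i c = Some x \<longrightarrow> S j c \<noteq> Some x))"

definition total :: "nat \<Rightarrow> (nat \<Rightarrow> nat \<Rightarrow> 'a option) \<Rightarrow> nat" where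
  "total t S = (\<Sum>i<t. card (dom (S i)))"

definition optimal :: "nat \<Rightarrow> (nat \<Rightarrow> nat \<Rightarrow> 'a option) \<Rightarrow> bool" where
  "optimal t S \<longleftrightarrow> family t S \<and> (\<forall>S'. family t S' \<longrightarrow> total t S' \<le> total t S)"

definition available :: "nat \<Rightarrow> (nat \<Rightarrow> nat \<Rightarrow> 'a option) \<Rightarrow> nat \<Rightarrow> nat \<Rightarrow> 'a set" where
  "available t S j c = {x \<in> B c. \<forall>i<t. i \<noteq> j \<longrightarrow> S i c \<noteq> Some x}"

text \<open>These are the colours that can be made the missing one. Drawing \<open>g\<close> from the available elements means that it can replace
  the \<open>j\<close>-th member while all others stay as they are; equal size keeps the family optimal.\<close>

definition good :: "nat \<Rightarrow> (nat \<Rightarrow> nat \<Rightarrow> 'a option) \<Rightarrow> nat \<Rightarrow> nat set" where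
  "good t S j = {c \<in> {1..rank}. \<exists>g. rainbow (available t S j) g \<and> card (dom g) = card (dom (S j))
     \<and> cl (ran g) = cl (ran (S j)) \<and> g c = None}"

lemma card_available:
  assumes "j < t" "c \<in> {1..rank}"
  shows "rank < card (available t S j c) + t"
proof -
  let ?U = "(\<lambda>i. the (S i c)) ` ({..<t} - {j})"
  have sub: "B c \<subseteq> available t S j c \<union> ?U"
    unfolding available_def by force
  have fin: "finite (available t S j c)"
    using finite_B[OF assms(2)] by (simp add: available_def)
  have "rank \<le> card (available t S j c \<union> ?U)"
    using card_mono[OF _ sub] fin card_B[OF assms(2)] by simp
  also have "\<dots> \<le> card (available t S j c) + card ?U" by (rule card_Un_le)
  also have "card ?U \<le> card ({..<t} - {j})" by (rule card_image_le) simp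
  also have "card ({..<t} - {j}) = t - 1" using assms(1) by simp
  finally show ?thesis using assms(1) by linarith
qed

lemma rainbow_available:
  assumes "family t S" "j < t"
  shows "rainbow (available t S j) (S j)"
  using assms unfolding family_def rainbow_def available_def by blast

lemma family_upd:
  assumes "family t S" "j < t" "rainbow (available t S j) f"
  shows "family t (S(j := f))"
proof -
  have r: "rainbow B f"
    by (rule rainbow_mono[OF assms(3)]) (auto simp: available_def)
  have n: "S i c \<noteq> Some x" if "f c = Some x" "i < t" "i \<noteq> j" for i c x
    using rainbowD(3)[OF assms(3) that(1)] that unfolding available_def by blast
  have "(S(j := f)) i c \<noteq> Some x" if i: "i' < t" "i < t" "i' \<noteq> i" "(S(j := f)) i' c = Some x" for i i' c x
  proof -
    consider "i' = j" "i \<noteq> j" | "i' \<noteq> j" "i = j" | "i' \<noteq> j" "i \<noteq> j"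
      using i(3) by blast
    then show ?thesis
    proof cases
      case 1
      then show ?thesis using i n by simp
    next
      case 2
      then show ?thesis using i n[of c x i'] by auto
    next
      case 3
      then show ?thesis using i assms(1) unfolding family_def by simp
    qed
  qed
  moreover have "rainbow B ((S(j := f)) i)" if "i < t" for i
    using that assms(1) r unfolding family_def by simp
  ultimately show ?thesis unfolding family_def by blast
qed

lemma total_upd:
  assumes "j < t"
  shows "total t (S(j := f)) + card (dom (S j)) = total t S + card (dom f)"
proof -
  have split: "total t S' = card (dom (S' j)) + (\<Sum>i\<in>{..<t} - {j}. card (dom (S' i)))" for S'
    unfolding total_def using assms by (subst sum.remove[of _ j]) auto
  have "(\<Sum>i\<in>{..<t} - {j}. card (dom ((S(j := f)) i))) = (\<Sum>i\<in>{..<t} - {j}. card (dom (S i)))"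
    by (rule sum.cong) auto
  then show ?thesis using split[of S] split[of "S(j := f)"] by simp
qed

lemma optimal_card_le:
  assumes "optimal t S" "j < t" "rainbow (available t S j) f"
  shows "card (dom f) \<le> card (dom (S j))"
proof -
  have "family t (S(j := f))" using family_upd assms unfolding optimal_def by blast
  then have "total t (S(j := f)) \<le> total t S" using assms(1) unfolding optimal_def by blast
  then show ?thesis using total_upd[OF assms(2), of S f] by linarith
qed

lemma rank_le_card_good:
  assumes S: "optimal t S" and j: "j < t" and b: "b \<in> {1..rank}" "S j b = None"
    and t: "t + \<kappa> \<le> rank"
  shows "rank \<le> card (good t S j) + \<beta>"
  unfolding good_def
proof (rule many_missable_colours)
  show "available t S j c \<subseteq> B c \<and> \<kappa> < card (available t S j c)" if "c \<in> {1..rank}" for c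
    using card_available[OF j that, of S] t by (auto simp: available_def)
  show "rainbow (available t S j) (S j)"
    using rainbow_available S j unfolding optimal_def by blast
  show "card (dom g) \<le> card (dom (S j))" if "rainbow (available t S j) g" for g
    by (rule optimal_card_le[OF S j that])
qed (fact b)+

text \<open>First change the \<open>j\<close>-th member so that it misses \<open>c\<close> and keeps its closure; then \<open>z\<close> can be added to it. As
  the family is optimal, the colour-\<open>c\<close> copy of \<open>z\<close> must belong to another member, from which it is taken.\<close>

lemma shift_deficiency:
  assumes S: "optimal t S" and j: "j < t" and c: "c \<in> good t S j"
    and z: "z \<in> B c" "z \<notin> cl (ran (S j))"
  shows "\<exists>i<t. S i c = Some z \<and> (\<exists>S'. optimal t S' \<and> (\<forall>l. l \<noteq> i \<longrightarrow> l \<noteq> j \<longrightarrow> S' l = S l)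
     \<and> S' i = (S i)(c := None))"
proof -
  obtain g where g: "rainbow (available t S j) g" "card (dom g) = card (dom (S j))"
    "cl (ran g) = cl (ran (S j))" "g c = None" and cr: "c \<in> {1..rank}"
    using c unfolding good_def by blast
  have fam: "family t S" using S unfolding optimal_def by blast
  have gi: "indep (ran g)" using rainbowD(4)[OF g(1)] .
  have zE: "z \<in> E" using z(1) cr B_subset_ground by blast
  then have zg: "z \<notin> ran g" "indep (insert z (ran g))" using z(2) g(3) by (auto simp: cl_def)
  have cg: "card (dom (g(c \<mapsto> z))) = Suc (card (dom g))"
    using g(4) rainbowD(5)[OF g(1)] by (simp add: domIff)
  have "z \<notin> available t S j c"
  proof
    assume "z \<in> available t S j c"
    then have "rainbow (available t S j) (g(c \<mapsto> z))"
      using rainbow_insert[OF g(1) cr g(4)] zg by blast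
    then show False using optimal_card_le[OF S j] cg g(2) by fastforce
  qed
  then obtain i where i: "i < t" "i \<noteq> j" "S i c = Some z"
    using z(1) unfolding available_def by blast
  define S1 where "S1 = S(i := (S i)(c := None))"
  define S2 where "S2 = S1(j := g(c \<mapsto> z))"
  have S1: "family t S1"
    unfolding S1_def
    by (rule family_upd[OF fam i(1) rainbow_remove[OF rainbow_available[OF fam i(1)]]])
  have mono: "available t S j d \<subseteq> available t S1 j d" for d
    unfolding available_def S1_def by auto
  have zav: "z \<in> available t S1 j c"
    using z(1) fam i unfolding available_def S1_def family_def by auto
  have "rainbow (available t S1 j) (g(c \<mapsto> z))"
    by (rule rainbow_insert[OF rainbow_mono[OF g(1) mono] cr g(4) zav zg])
  then have S2: "family t S2" unfolding S2_def by (rule family_upd[OF S1 j])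
  have "card (dom (S i)) = Suc (card (dom ((S i)(c := None))))"
  proof -
    have "finite (dom (S i))" using rainbowD(5) rainbow_available[OF fam i(1)] by blast
    moreover have "c \<in> dom (S i)" using i(3) by blast
    ultimately show ?thesis using card.remove[of "dom (S i)" c] by simp
  qed
  moreover have "S1 j = S j" using i(2) by (simp add: S1_def)
  ultimately have "total t S2 = total t S"
    using total_upd[OF j, of S1 "g(c \<mapsto> z)"] total_upd[OF i(1), of S "(S i)(c := None)"] cg g(2)
    unfolding S1_def[symmetric] S2_def[symmetric] by simp
  then have "optimal t S2" using S S2 unfolding optimal_def by simp
  moreover have "\<forall>l. l \<noteq> i \<longrightarrow> l \<noteq> j \<longrightarrow> S2 l = S l" by (simp add: S1_def S2_def)
  moreover have "S2 i = (S i)(c := None)" using i(2) by (simp add: S1_def S2_def)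
  ultimately show ?thesis using i by blast
qed


section \<open>Trees of exchanges\<close>

text \<open>A pair \<open>(S, j)\<close> stands for an optimal family \<open>S\<close> whose \<open>j\<close>-th member is deficient.\<close>

definition flat :: "((nat \<Rightarrow> nat \<Rightarrow> 'a option) \<times> nat) set \<Rightarrow> 'a set" where
  "flat Q = {x \<in> E. \<forall>(S, j)\<in>Q. x \<in> cl (ran (S j))}"

text \<open>The intended families are those reached from \<open>S\<^sub>0\<close> by a tree of exchanges. Of this history only one trace is kept: they
  agree with \<open>S\<^sub>0\<close> except at the few indices that occur as deficient somewhere in \<open>Q\<close>: a member
  at any other index is the same set in all families of \<open>Q\<close> and has to be counted only once.\<close>

definition exchange_tree ::
  "nat \<Rightarrow> (nat \<Rightarrow> nat \<Rightarrow> 'a option) \<Rightarrow> ((nat \<Rightarrow> nat \<Rightarrow> 'a option) \<times> nat) set \<Rightarrow> bool" where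
  "exchange_tree t S\<^sub>0 Q \<longleftrightarrow> finite Q
     \<and> (\<forall>(S, j)\<in>Q. optimal t S \<and> j < t \<and> (\<exists>b\<in>{1..rank}. S j b = None)
          \<and> (\<forall>i. i \<notin> snd ` Q \<longrightarrow> S i = S\<^sub>0 i))
     \<and> (\<exists>j. (S\<^sub>0, j) \<in> Q)"

lemma exchange_treeD:
  assumes "exchange_tree t S\<^sub>0 Q"
  shows "finite Q" "q \<in> Q \<Longrightarrow> optimal t (fst q)" "q \<in> Q \<Longrightarrow> snd q < t"
    "q \<in> Q \<Longrightarrow> \<exists>b\<in>{1..rank}. fst q (snd q) b = None"
    "q \<in> Q \<Longrightarrow> i \<notin> snd ` Q \<Longrightarrow> fst q i = S\<^sub>0 i" "\<exists>j. (S\<^sub>0, j) \<in> Q"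
  using assms unfolding exchange_tree_def by (auto simp: case_prod_beta)

definition common_good :: "nat \<Rightarrow> ((nat \<Rightarrow> nat \<Rightarrow> 'a option) \<times> nat) set \<Rightarrow> nat set" where
  "common_good t Q = {c \<in> {1..rank}. \<forall>q\<in>Q. c \<in> good t (fst q) (snd q)}"

lemma rank_le_card_common_good:
  assumes Q: "exchange_tree t S\<^sub>0 Q" and t: "t + \<kappa> \<le> rank"
  shows "rank \<le> card (common_good t Q) + card Q * \<beta>"
proof -
  let ?bad = "\<lambda>q. {1..rank} - good t (fst q) (snd q)"
  have "card (?bad q) \<le> \<beta>" if "q \<in> Q" for q
  proof -
    have "rank \<le> card (good t (fst q) (snd q)) + \<beta>"
      using rank_le_card_good[OF exchange_treeD(2)[OF Q that] exchange_treeD(3)[OF Q that] _ _ t]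
        exchange_treeD(4)[OF Q that] by blast
    moreover have "good t (fst q) (snd q) \<subseteq> {1..rank}" unfolding good_def by blast
    ultimately show ?thesis by (simp add: card_Diff_subset finite_subset[of _ "{1..rank}"])
  qed
  then have "(\<Sum>q\<in>Q. card (?bad q)) \<le> of_nat (card Q) * \<beta>" by (intro sum_bounded_above) auto
  moreover have "card (\<Union>q\<in>Q. ?bad q) \<le> (\<Sum>q\<in>Q. card (?bad q))"
    by (rule card_UN_le) (rule exchange_treeD(1)[OF Q])
  moreover have "card {1..rank} \<le> card (common_good t Q \<union> (\<Union>q\<in>Q. ?bad q))"
    by (rule card_mono) (auto simp: common_good_def exchange_treeD(1)[OF Q])
  moreover have "\<dots> \<le> card (common_good t Q) + card (\<Union>q\<in>Q. ?bad q)" by (rule card_Un_le)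
  ultimately show ?thesis by simp
qed

text \<open>Every element of a common good colour outside the flat lies outside the closure of some deficient set of \<open>Q\<close> and is
  therefore in use in the corresponding family. The assumption \<open>cover\<close> puts it into the part \<open>h f\<close>
  of the member \<open>f\<close> that uses it. At indices that are nowhere deficient there are at most \<open>t\<close> different
  members altogether; at the at most \<open>card Q\<close> deficient indices there may be one for each element of \<open>Q\<close>.\<close>

lemma sum_outside_flat_le:
  fixes h :: "(nat \<Rightarrow> 'a option) \<Rightarrow> (nat \<times> 'a) set"
  assumes Q: "exchange_tree t S\<^sub>0 Q"
    and h: "\<And>f. rainbow B f \<Longrightarrow> finite (h f) \<and> card (h f) \<le> u"
    and cover: "\<And>q i c z. q \<in> Q \<Longrightarrow> i < t \<Longrightarrow> c \<in> good t (fst q) (snd q) \<Longrightarrow> z \<in> B c \<Longrightarrow>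
      z \<notin> cl (ran (fst q (snd q))) \<Longrightarrow> fst q i c = Some z \<Longrightarrow> (c, z) \<in> h (fst q i)"
  shows "(\<Sum>c\<in>common_good t Q. card (B c - flat Q)) \<le> u * (t + card Q * card Q)"
proof -
  let ?G = "common_good t Q"
  let ?J = "snd ` Q"
  have fQ: "finite Q" by (rule exchange_treeD(1)[OF Q])
  have rb: "rainbow B (fst q i)" if "q \<in> Q" "i < t" for q i
    using exchange_treeD(2)[OF Q that(1)] that(2) unfolding optimal_def family_def by blast
  have rb0: "rainbow B (S\<^sub>0 i)" if "i < t" for i
    using exchange_treeD(6)[OF Q] rb[OF _ that] by fastforce
  have J: "j < t" if "j \<in> ?J" for j using that exchange_treeD(3)[OF Q] by blast
  have G: "c \<in> {1..rank}" if "c \<in> ?G" for c using that unfolding common_good_def by blast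
  have fG: "finite ?G" unfolding common_good_def by simp
  have sub: "Sigma ?G (\<lambda>c. B c - flat Q)
    \<subseteq> (\<Union>i\<in>{..<t}. h (S\<^sub>0 i)) \<union> (\<Union>(q, i)\<in>Q \<times> ?J. h (fst q i))"
  proof
    fix p assume "p \<in> Sigma ?G (\<lambda>c. B c - flat Q)"
    then obtain c z where p: "p = (c, z)" "c \<in> ?G" "z \<in> B c" "z \<notin> flat Q" by blast
    have "z \<in> E" using p G B_subset_ground by blast
    then obtain q where q: "q \<in> Q" "z \<notin> cl (ran (fst q (snd q)))"
      using p(4) unfolding flat_def by (auto simp: case_prod_beta)
    have good: "c \<in> good t (fst q) (snd q)" using p(2) q(1) unfolding common_good_def by blast
    obtain i where i: "i < t" "fst q i c = Some z"
      using shift_deficiency[OF exchange_treeD(2)[OF Q q(1)] exchange_treeD(3)[OF Q q(1)] good p(3) q(2)]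
      by blast
    have ph: "p \<in> h (fst q i)" using cover[OF q(1) i(1) good p(3) q(2) i(2)] p(1) by simp
    show "p \<in> (\<Union>i\<in>{..<t}. h (S\<^sub>0 i)) \<union> (\<Union>(q, i)\<in>Q \<times> ?J. h (fst q i))"
    proof (cases "i \<in> ?J")
      case True
      then have "p \<in> (\<Union>(q, i)\<in>Q \<times> ?J. h (fst q i))" using ph q(1) by blast
      then show ?thesis by (rule UnI2)
    next
      case False
      then have "p \<in> h (S\<^sub>0 i)" using ph exchange_treeD(5)[OF Q q(1)] by simp
      then show ?thesis using i(1) by blast
    qed
  qed
  have fin: "finite ((\<Union>i\<in>{..<t}. h (S\<^sub>0 i)) \<union> (\<Union>(q, i)\<in>Q \<times> ?J. h (fst q i)))"
    using h rb0 rb J fQ by (auto simp: case_prod_beta)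
  have "(\<Sum>c\<in>?G. card (B c - flat Q)) = card (Sigma ?G (\<lambda>c. B c - flat Q))"
    using fG G finite_B by (subst card_SigmaI) auto
  also have "\<dots> \<le> card ((\<Union>i\<in>{..<t}. h (S\<^sub>0 i)) \<union> (\<Union>(q, i)\<in>Q \<times> ?J. h (fst q i)))"
    by (rule card_mono[OF fin sub])
  also have "\<dots> \<le> card (\<Union>i\<in>{..<t}. h (S\<^sub>0 i)) + card (\<Union>(q, i)\<in>Q \<times> ?J. h (fst q i))"
    by (rule card_Un_le)
  also have "card (\<Union>i\<in>{..<t}. h (S\<^sub>0 i)) \<le> (\<Sum>i<t. card (h (S\<^sub>0 i)))"
    by (rule card_UN_le) simp
  also have "(\<Sum>i<t. card (h (S\<^sub>0 i))) \<le> of_nat (card {..<t}) * u"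
    using h rb0 by (intro sum_bounded_above) auto
  also have "card (\<Union>(q, i)\<in>Q \<times> ?J. h (fst q i)) \<le> (\<Sum>p\<in>Q \<times> ?J. card (case p of (q, i) \<Rightarrow> h (fst q i)))"
    by (rule card_UN_le) (use fQ in simp)
  also have "\<dots> \<le> of_nat (card (Q \<times> ?J)) * u"
  proof (rule sum_bounded_above)
    fix p assume p: "p \<in> Q \<times> ?J"
    then have "fst p \<in> Q" "snd p \<in> ?J" unfolding mem_Times_iff by blast+
    then have "fst p \<in> Q" "snd p < t" using J by blast+
    then have "rainbow B (fst (fst p) (snd p))" by (rule rb)
    then show "card (case p of (q, i) \<Rightarrow> h (fst q i)) \<le> u" using h by (simp add: case_prod_beta)
  qed
  also have "card (Q \<times> ?J) \<le> card Q * card Q"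
    using card_image_le[OF fQ, of snd] by (simp add: card_cartesian_product)
  finally have "(\<Sum>c\<in>?G. card (B c - flat Q)) \<le> t * u + card Q * card Q * u" by simp
  then show ?thesis by (simp add: algebra_simps)
qed

lemma flat_subset_ground: "flat Q \<subseteq> E"
  unfolding flat_def by blast

lemma card_Diff_flat_ge:
  assumes "c \<in> {1..rank}"
  shows "rank - rk X \<le> card (B c - X)"
proof -
  have "card (B c \<inter> X) \<le> rk X"
    using card_le_rk[of "B c \<inter> X" X] indep_subset[OF indep_B[OF assms]] by blast
  moreover have "card (B c) = card (B c \<inter> X) + card (B c - X)"
    using finite_B[OF assms] by (subst card_Un_disjoint[symmetric]) (auto intro: arg_cong[where f = card])
  ultimately show ?thesis using card_B[OF assms] by simp
qed

text \<open>Let \<open>p\<close> be the corank of the flat \<open>F\<close> of \<open>Q\<close>. If no exchange makes \<open>F\<close> smaller, then \<open>F\<close> is contained in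
  the closure of \<open>f - {z}\<close> for every element \<open>z\<close> that can be taken out of a member \<open>f\<close>. By
  \<open>rk_add_card_le_rank\<close> each member has at most \<open>p\<close> such elements, so there are at most
  \<open>p (t + \<beta>\<^sup>2)\<close> of them. But each of the at least \<open>n - \<beta>\<^sup>2\<close> common good colours provides at least \<open>p\<close>.\<close>

lemma extend_exchange_tree:
  assumes Q: "exchange_tree t S\<^sub>0 Q" and m: "card Q \<le> \<beta>" "rk (flat Q) < rank" "rank \<le> rk (flat Q) + \<beta>"
    and t: "t + \<kappa> \<le> rank" "t + 2 * \<beta>\<^sup>2 < rank"
  shows "\<exists>Q'. exchange_tree t S\<^sub>0 Q' \<and> card Q' \<le> Suc (card Q) \<and> rk (flat Q') < rk (flat Q)"
proof (rule ccontr)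
  assume none: "\<not> ?thesis"
  let ?F = "flat Q" and ?p = "rank - rk (flat Q)"
  define h :: "(nat \<Rightarrow> 'a option) \<Rightarrow> (nat \<times> 'a) set"
    where "h f = {(c, z). f c = Some z \<and> ?F \<subseteq> cl (ran f - {z})}" for f
  have "(\<Sum>c\<in>common_good t Q. card (B c - flat Q)) \<le> ?p * (t + card Q * card Q)"
  proof (rule sum_outside_flat_le[OF Q])
    fix f assume f: "rainbow B f"
    have inj: "inj_on snd (h f)"
    proof (rule inj_onI)
      fix a b assume "a \<in> h f" "b \<in> h f" "snd a = snd b"
      then obtain c d z where cd: "a = (c, z)" "b = (d, z)" "f c = Some z" "f d = Some z"
        unfolding h_def by auto
      then have "c = d" using rainbowD(2)[OF f] by (metis domI inj_onD)
      then show "a = b" using cd by simp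
    qed
    have R: "snd ` h f \<subseteq> ran f" unfolding h_def by (auto intro: ranI)
    have fin: "finite (h f)"
      using finite_imageD[OF finite_subset[OF R finite_indep[OF rainbowD(4)[OF f]]] inj] .
    have "card (snd ` h f) + rk ?F \<le> rank"
      by (rule rk_add_card_le_rank[OF rainbowD(4)[OF f] R]) (auto simp: h_def)
    then show "finite (h f) \<and> card (h f) \<le> ?p" using fin inj by (simp add: card_image)
  next
    fix q i c z
    assume q: "q \<in> Q" and i: "i < t" and c: "c \<in> good t (fst q) (snd q)" and z: "z \<in> B c"
      "z \<notin> cl (ran (fst q (snd q)))" and used: "fst q i c = Some z"
    obtain S j where Sj: "q = (S, j)" by (cases q)
    have S: "optimal t S" and j: "j < t" "j \<in> snd ` Q"
      using exchange_treeD(2,3)[OF Q q] q unfolding Sj by force+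
    have fam: "family t S" using S unfolding optimal_def by blast
    obtain i' S' where S': "i' < t" "S i' c = Some z" "optimal t S'"
      "\<forall>l. l \<noteq> i' \<longrightarrow> l \<noteq> j \<longrightarrow> S' l = S l" "S' i' = (S i')(c := None)"
      using shift_deficiency[OF S j(1), of c z] c z unfolding Sj by auto
    have "S i c = Some z" using used unfolding Sj by simp
    then have "i' = i" using fam S'(1,2) i unfolding family_def by blast
    note S' = S'[unfolded this]
    have rSi: "rainbow B (S i)" using fam i unfolding family_def by blast
    have cr: "c \<in> {1..rank}" using c unfolding good_def by blast
    have ranS': "ran (S' i) = ran (S i) - {z}"
      using ran_remove[OF rainbowD(2)[OF rSi] S'(2)] S'(5) by simp
    \<comment> \<open>If \<open>F\<close> were not contained in the closure of \<open>S i - {z}\<close>, this pair would lower its rank.\<close>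
    let ?Q = "insert (S', i) Q"
    have "exchange_tree t S\<^sub>0 ?Q"
    proof -
      have "S' l = S\<^sub>0 l" if "l \<notin> snd ` ?Q" for l
      proof -
        have "S' l = S l" using that S'(4) j(2) by auto
        also have "S l = S\<^sub>0 l" using exchange_treeD(5)[OF Q q] that unfolding Sj by auto
        finally show ?thesis .
      qed
      moreover have "S' i c = None" using S'(5) by simp
      ultimately show ?thesis using Q S'(3) i cr unfolding exchange_tree_def by auto
    qed
    moreover have "card ?Q \<le> Suc (card Q)" by (rule card_insert_le_m1) auto
    ultimately have "\<not> rk (flat ?Q) < rk ?F" using none by blast
    moreover have "flat ?Q = ?F \<inter> cl (ran (S' i))" unfolding flat_def by auto
    moreover have "indep (ran (S' i))"
      using S'(3) i rainbowD(4) unfolding optimal_def family_def by blast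
    ultimately have "?F \<subseteq> cl (ran (S' i))" using rk_inter_cl_less flat_subset_ground by metis
    then show "(c, z) \<in> h (fst q i)" using S'(2) ranS' unfolding h_def Sj by simp
  qed
  moreover have "card (common_good t Q) * ?p \<le> (\<Sum>c\<in>common_good t Q. card (B c - flat Q))"
    using sum_bounded_below[of "common_good t Q" ?p "\<lambda>c. card (B c - flat Q)"] card_Diff_flat_ge
    unfolding common_good_def by simp
  ultimately have "card (common_good t Q) * ?p \<le> ?p * (t + card Q * card Q)"
    by (rule le_trans[rotated])
  then have "card (common_good t Q) * ?p \<le> (t + card Q * card Q) * ?p"
    by (subst (asm) (2) mult.commute)
  moreover have "0 < ?p" using m(2) by simp
  ultimately have "card (common_good t Q) \<le> t + card Q * card Q"
    unfolding mult_le_cancel2 by blast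
  moreover have "card Q * card Q \<le> \<beta> * \<beta>" "card Q * \<beta> \<le> \<beta> * \<beta>"
    using m(1) by (simp_all add: mult_le_mono)
  ultimately show False
    using rank_le_card_common_good[OF Q t(1)] t(2) unfolding power2_eq_square by linarith
qed

text \<open>A set with more than \<open>n\<close> elements would contain an independent set of \<open>n - \<beta>\<close> elements, more than its rank.\<close>

lemma card_le_rank_of_rk_small:
  assumes X: "X \<subseteq> E" "rk X + \<beta> < rank"
  shows "card X \<le> rank"
proof (rule ccontr)
  assume "\<not> card X \<le> rank"
  then have "rank - \<beta> \<le> card X" by simp
  then obtain Y where Y: "Y \<subseteq> X" "card Y = rank - \<beta>"
    by (rule obtain_subset_with_card_n)
  then have "indep Y" using small_indep[of Y] X by auto
  then show False using card_le_rk[of Y X] Y X(2) by simp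
qed

text \<open>The flat has at most \<open>n\<close> elements, each in at most \<open>\<kappa>\<close> of the bases, so among the elements of
  the common good colours all but \<open>\<kappa> n\<close> lie outside the flat and are in use.\<close>

lemma no_deep_exchange_tree:
  assumes Q: "exchange_tree t S\<^sub>0 Q" and m: "card Q \<le> Suc \<beta>" "rk (flat Q) + \<beta> < rank"
  shows "rank \<le> t + (Suc \<beta>)\<^sup>2 + Suc \<beta> * \<beta> + \<kappa>"
proof (rule ccontr)
  assume big: "\<not> ?thesis"
  let ?F = "flat Q" and ?G = "common_good t Q"
  define h :: "(nat \<Rightarrow> 'a option) \<Rightarrow> (nat \<times> 'a) set" where "h f = {(c, z). f c = Some z}" for f
  have G: "c \<in> {1..rank}" if "c \<in> ?G" for c using that unfolding common_good_def by blast
  have fG: "finite ?G" unfolding common_good_def by simp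
  have "(\<Sum>c\<in>?G. card (B c - ?F)) \<le> rank * (t + card Q * card Q)"
  proof (rule sum_outside_flat_le[OF Q])
    fix f assume f: "rainbow B f"
    have img: "h f = (\<lambda>c. (c, the (f c))) ` dom f" unfolding h_def by force
    have "card (h f) \<le> card (dom f)"
      unfolding img by (rule card_image_le[OF rainbowD(5)[OF f]])
    also have "\<dots> \<le> card {1..rank}" by (rule card_mono[OF _ rainbowD(1)[OF f]]) simp
    finally show "finite (h f) \<and> card (h f) \<le> rank" using rainbowD(5)[OF f] unfolding img by simp
  qed (simp add: h_def)
  moreover have "(\<Sum>c\<in>?G. card (B c - ?F)) + (\<Sum>c\<in>?G. card (B c \<inter> ?F)) = rank * card ?G"
  proof -
    have "card (B c - ?F) + card (B c \<inter> ?F) = rank" if "c \<in> ?G" for c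
    proof -
      have "card (B c) = card ((B c - ?F) \<union> (B c \<inter> ?F))" by (rule arg_cong[where f = card]) blast
      also have "\<dots> = card (B c - ?F) + card (B c \<inter> ?F)"
        using finite_B[OF G[OF that]] by (intro card_Un_disjoint) auto
      finally show ?thesis using card_B[OF G[OF that]] by simp
    qed
    then show ?thesis by (simp add: sum.distrib[symmetric])
  qed
  moreover have "(\<Sum>c\<in>?G. card (B c \<inter> ?F)) \<le> \<kappa> * card ?F"
  proof (rule sum_card_Int_le[OF fG])
    show "finite ?F" using flat_subset_ground finite_ground finite_subset by blast
    fix x assume x: "x \<in> ?F"
    have "card {c \<in> ?G. x \<in> B c} \<le> card {c \<in> {1..rank}. x \<in> B c}"
      by (rule card_mono) (use G in auto)
    also have "\<dots> \<le> \<kappa>" by (rule overlap) (use x flat_subset_ground in blast)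
    finally show "card {c \<in> ?G. x \<in> B c} \<le> \<kappa>" .
  qed
  moreover have "\<kappa> * card ?F \<le> rank * \<kappa>"
    using card_le_rank_of_rk_small[OF flat_subset_ground m(2)] by (simp add: mult.commute)
  ultimately have "rank * card ?G \<le> rank * (t + card Q * card Q) + rank * \<kappa>"
    by linarith
  then have "rank * card ?G \<le> rank * (t + card Q * card Q + \<kappa>)"
    by (simp only: distrib_left)
  then have "card ?G \<le> t + card Q * card Q + \<kappa>" using m(2) by simp
  moreover have "card Q * card Q \<le> (Suc \<beta>)\<^sup>2" "card Q * \<beta> \<le> Suc \<beta> * \<beta>"
    using m(1) unfolding power2_eq_square by (simp_all only: mult_le_mono le_refl)
  moreover have "rank \<le> card ?G + card Q * \<beta>"
    by (rule rank_le_card_common_good[OF Q]) (use big in linarith)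
  ultimately show False using big by linarith
qed

section \<open>Rainbow bases from an optimal family\<close>

text \<open>A deficient member would be the root of an exchange tree. Each extension of the tree adds one pair and lowers the
  rank of its flat by at least one, so after at most \<open>\<beta>\<close> extensions the tree is one that
  \<open>no_deep_exchange_tree\<close> excludes.\<close>

lemma optimal_complete:
  assumes t: "t + (Suc \<beta>)\<^sup>2 + Suc \<beta> * \<beta> + \<kappa> < rank" and S: "optimal t S" and j: "j < t"
  shows "dom (S j) = {1..rank}"
proof (rule ccontr)
  assume "dom (S j) \<noteq> {1..rank}"
  moreover have rS: "rainbow B (S j)" using S j unfolding optimal_def family_def by blast
  ultimately obtain b where b: "b \<in> {1..rank}" "S j b = None"
    using rainbowD(1)[OF rS] by (metis domIff subsetI subset_antisym)
  have le: "2 * \<beta>\<^sup>2 \<le> (Suc \<beta>)\<^sup>2 + Suc \<beta> * \<beta>" by (simp add: power2_eq_square)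
  have "\<exists>Q. exchange_tree t S Q \<and> card Q \<le> Suc m \<and> rk (flat Q) + m < rank" if "m \<le> \<beta>" for m
    using that
  proof (induction m)
    case 0
    \<comment> \<open>The closure of a deficient member has rank less than \<open>n\<close>.\<close>
    have "card (dom (S j)) < card {1..rank}"
    proof (rule psubset_card_mono)
      show "dom (S j) \<subset> {1..rank}" using rainbowD(1)[OF rS] b by blast
    qed simp
    moreover have "rk (flat {(S, j)}) \<le> card (ran (S j))"
    proof -
      obtain I where I: "indep I" "I \<subseteq> flat {(S, j)}" "card I = rk (flat {(S, j)})"
        by (rule rk_witness)
      have "I \<subseteq> cl (ran (S j))" using I(2) unfolding flat_def by auto
      then show ?thesis using card_indep_in_cl[OF rainbowD(4)[OF rS] I(1)] I(3) by simp
    qed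
    moreover have "exchange_tree t S {(S, j)}"
      using S j b unfolding exchange_tree_def by auto
    ultimately show ?case using rainbowD(6)[OF rS] by (intro exI[of _ "{(S, j)}"]) simp
  next
    case (Suc m)
    then obtain Q where Q: "exchange_tree t S Q" "card Q \<le> Suc m" "rk (flat Q) + m < rank"
      by auto
    show ?case
    proof (cases "rk (flat Q) + Suc m < rank")
      case True
      then show ?thesis using Q by (intro exI[of _ Q]) simp
    next
      case False
      have "\<exists>Q'. exchange_tree t S Q' \<and> card Q' \<le> Suc (card Q) \<and> rk (flat Q') < rk (flat Q)"
        by (rule extend_exchange_tree[OF Q(1)]) (use Q False Suc.prems t le in linarith)+
      then obtain Q' where "exchange_tree t S Q'" "card Q' \<le> Suc (card Q)"
        "rk (flat Q') < rk (flat Q)" by blast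
      then show ?thesis using Q(2,3) by (intro exI[of _ Q']) simp
    qed
  qed
  then obtain Q where "exchange_tree t S Q" "card Q \<le> Suc \<beta>" "rk (flat Q) + \<beta> < rank" by blast
  from no_deep_exchange_tree[OF this] t show False by simp
qed

lemma exists_optimal: "\<exists>S. optimal t S"
proof -
  have "family t (\<lambda>_ _. None)"
    unfolding family_def rainbow_def using indep_empty by (simp add: dom_def)
  moreover have "total t S < Suc (t * rank)" if "family t S" for S
  proof -
    have "card (dom (S i)) \<le> rank" if "i \<in> {..<t}" for i
    proof -
      have "rainbow B (S i)" using that \<open>family t S\<close> unfolding family_def by blast
      then show ?thesis using card_mono[OF _ rainbowD(1)] by fastforce
    qed
    then have "total t S \<le> of_nat (card {..<t}) * rank"
      unfolding total_def by (rule sum_bounded_above)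
    then show ?thesis by simp
  qed
  ultimately obtain S where "family t S" "\<forall>S'. family t S' \<longrightarrow> total t S' \<le> total t S"
    using ex_has_greatest_nat[of "family t" _ "total t"] by blast
  then show ?thesis unfolding optimal_def by blast
qed

theorem many_disjoint_rainbow_bases:
  assumes t: "t + (Suc \<beta>)\<^sup>2 + Suc \<beta> * \<beta> + \<kappa> < rank"
  shows "t \<le> max_disjoint_rainbow_bases B"
proof -
  obtain S where S: "optimal t S" using exists_optimal by blast
  let ?C = "{1..rank}"
  define r where "r i = restrict (\<lambda>c. the (S i c)) ?C" for i
  have dom: "dom (S i) = ?C" if "i < t" for i using optimal_complete[OF t S that] .
  have val: "S i c = Some (r i c)" if "i < t" "c \<in> ?C" for i c
  proof -
    have "c \<in> dom (S i)" using dom that by blast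
    then show ?thesis using that(2) unfolding r_def by auto
  qed
  have fam: "family t S" using S unfolding optimal_def by blast
  have rb: "rainbow_base B (r i)" if i: "i < t" for i
  proof -
    have Si: "rainbow B (S i)" using fam i unfolding family_def by blast
    have "ran (S i) = r i ` ?C"
    proof (intro equalityI subsetI)
      fix x assume "x \<in> ran (S i)"
      then obtain c where c: "S i c = Some x" by (auto simp: ran_def)
      then have "c \<in> ?C" using dom[OF i] by blast
      then show "x \<in> r i ` ?C" using val[OF i] c by force
    next
      fix x assume "x \<in> r i ` ?C"
      then obtain c where "c \<in> ?C" "x = r i c" by blast
      then show "x \<in> ran (S i)" using val[OF i] by (blast intro: ranI)
    qed
    moreover have "card (ran (S i)) = rank" using rainbowD(6)[OF Si] dom[OF i] by simp
    ultimately have "base (r i ` ?C)" using rainbowD(4)[OF Si] base_iff by simp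
    moreover have "inj_on (r i) ?C"
    proof (rule inj_onI)
      fix c d assume cd: "c \<in> ?C" "d \<in> ?C" "r i c = r i d"
      then have "S i c = S i d" using val[OF i] by simp
      then show "c = d" using inj_onD[OF rainbowD(2)[OF Si]] cd(1,2) unfolding dom[OF i] by blast
    qed
    moreover have "r i \<in> (\<Pi>\<^sub>E c\<in>?C. B c)"
    proof (rule PiE_I)
      show "r i c \<in> B c" if "c \<in> ?C" for c using rainbowD(3)[OF Si val[OF i that]] .
    qed (auto simp: r_def)
    ultimately show ?thesis unfolding rainbow_base_def by blast
  qed
  have ne: "r i c \<noteq> r j c" if "i < t" "j < t" "i \<noteq> j" "c \<in> ?C" for i j c
    using fam val[OF that(1,4)] val[OF that(2,4)] that(1-3) unfolding family_def by metis
  have "1 \<in> ?C" using t by simp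
  then have inj: "inj_on r {..<t}"
    by (intro inj_onI) (metis ne lessThan_iff)
  have "disjoint_rainbow_bases B (r ` {..<t})"
    unfolding disjoint_rainbow_bases_def pairwise_def using rb ne by (auto simp: image_iff) (metis ne)
  moreover have "card (r ` {..<t}) = t" using card_image[OF inj] by simp
  ultimately have "t \<in> {card R | R. disjoint_rainbow_bases B R}" by force
  moreover have "finite {card R | R. disjoint_rainbow_bases B R}"
  proof -
    have "finite (\<Pi>\<^sub>E c\<in>?C. B c)" using finite_B by (intro finite_PiE) auto
    then have "finite (card ` Pow (\<Pi>\<^sub>E c\<in>?C. B c))" by blast
    moreover have "{card R | R. disjoint_rainbow_bases B R} \<subseteq> card ` Pow (\<Pi>\<^sub>E c\<in>?C. B c)"
      unfolding disjoint_rainbow_bases_def rainbow_base_def by blast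
    ultimately show ?thesis by (rule rev_finite_subset)
  qed
  ultimately show ?thesis unfolding max_disjoint_rainbow_bases_def by (intro Max_ge)
qed

end

theorem theorem1p3:
  fixes \<beta> \<kappa> :: "nat \<Rightarrow> nat"
    and E :: "'a set" and indep :: "'a set \<Rightarrow> bool"
    and n :: nat and B :: "nat \<Rightarrow> 'a set"
  assumes "\<And>m. m \<ge> 1 \<Longrightarrow> \<beta> m \<ge> 1" and "\<And>m. m \<ge> 1 \<Longrightarrow> \<kappa> m \<ge> 1"
    and "(\<lambda>m. real (\<beta> m)) \<in> o(\<lambda>m. sqrt (real m))"
    and "(\<lambda>m. real (\<kappa> m)) \<in> o(\<lambda>m. sqrt (real m))"
    and "matroid E indep"
    and "matroid.rank indep = n"
    and "matroid.girth E indep + enat (\<beta> n) \<ge> enat (n + 1)"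
    and "matroid.base_sequence indep B"
    and "matroid.overlapping E indep \<kappa> B"
    and "n > 2 * ((2 * \<kappa> n + 2 * \<beta> n + 1)\<^sup>2 + \<beta> n)"
  shows "int (matroid.max_disjoint_rainbow_bases indep B)
    \<ge> int n - int ((2 * \<kappa> n + 2 * \<beta> n + 1)\<^sup>2) - int (\<beta> n) - 2"
proof -
  interpret matroid E indep by fact
  let ?k = "(2 * \<kappa> n + 2 * \<beta> n + 1)\<^sup>2"
  have rank: "rank = n" by fact
  have "indep X" if X: "X \<subseteq> E" "card X + \<beta> n \<le> rank" for X
  proof (rule indep_of_card_lt_girth[OF X(1)])
    show "enat (card X) < girth"
    proof (cases girth)
      case (enat g)
      then show ?thesis using assms(7) X(2) rank by simp
    qed simp
  qed
  moreover have "card {c \<in> {1..rank}. e \<in> B c} \<le> \<kappa> n" if "e \<in> E" for e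
    using assms(9) that rank unfolding overlapping_def by simp
  ultimately interpret high_girth_base_sequence E indep B "\<beta> n" "\<kappa> n"
    using assms(8) by unfold_locales auto
  let ?t = "n - ?k - \<beta> n - 2"
  have "(Suc (\<beta> n))\<^sup>2 + Suc (\<beta> n) * \<beta> n + \<kappa> n \<le> ?k + \<beta> n"
    by (simp add: power2_eq_square algebra_simps)
  \<comment> \<open>Where the difference truncates to 0, the bound \<open>a + b < n\<close> takes over.\<close>
  moreover have "n - a - b - 2 + x < n" if "x \<le> a + b" "2 * (a + b) < n" for a b x :: nat
    using that by arith
  ultimately have "?t + ((Suc (\<beta> n))\<^sup>2 + Suc (\<beta> n) * \<beta> n + \<kappa> n) < rank"
    using assms(10) rank by blast
  then have "?t + (Suc (\<beta> n))\<^sup>2 + Suc (\<beta> n) * \<beta> n + \<kappa> n < rank"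
    by (simp only: add.assoc)
  then have "?t \<le> max_disjoint_rainbow_bases B" by (rule many_disjoint_rainbow_bases)
  then show ?thesis by linarith
qed

end
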